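(* Let $F$ be a graph with at least one edge, and let $\mathcal{P}=\mathrm{Forb}(DF)$ be the property of digraphs containing no copy of $DF$, viewed as a property of $4$-colourings of complete graphs. Then for every $n$, \[\mathrm{ex}(n,\mathcal{P})=(1-\log_4 3)\,\mathrm{ex}(n,F)+\log_4 3\binom n2,\] where $\mathrm{ex}(n,F)$ is the Tur\'an number of $F$.
   Context: A digraph $D$ on $[n]$ has edge set $E(D)\subseteq\{(i,j):i\neq j\}$. $DF$ is the digraph obtained from $F$ by replacing each edge $xy$ with both directed edges $(x,y)$ and $(y,x)$; $D$ contains a copy of $DF$ if some subdigraph of $D$ is isomorphic to $DF$. A digraph $D$ on $[n]$ is encoded as the $4$-colouring $c$ of $E(K_n)=[n]^{(2)}$ where, for $i<j$, $c(ij)=1$ if neither $(i,j)$ nor $(j,i)$ is in $E(D)$, $2$ if only $(i,j)$ is, $3$ if only $(j,i)$ is, and $4$ if both are. A template for $K_n$ is $t:E(K_n)\to2^{[4]}\setminus\{\emptyset\}$, $\langle t\rangle$ is the set of colourings $c$ with $c(e)\in t(e)$ for all $e$, $\mathrm{Ent}(t)=\sum_e\log_4|t(e)|$, and $\mathrm{ex}(n,\mathcal{P})$ is the maximum of $\mathrm{Ent}(t)$ over templates $t$ all of whose realisations encode $DF$-free digraphs. $\mathrm{ex}(n,F)$ is the maximum number of edges in an $n$-vertex graph containing no copy of $F$. *)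

theory Defs
  imports Complex_Main "HOL-Library.FuncSet" "Graph_Theory.Graph_Theory"
begin

text \<open>
  The undirected graphs of \<^theory>\<open>Graph_Theory.Digraph\<close> are symmetric digraphs, which would identify
  a graph \<open>F\<close> with \<open>DF\<close>. Simple graphs are therefore given here by a set of two-element edges.
\<close>

record 'a ugraph =
  uverts :: "'a set"
  uedges :: "'a set set"

definition simple_graph :: "'a ugraph \<Rightarrow> bool" where
  "simple_graph G \<longleftrightarrow> finite (uverts G) \<and> (\<forall>e\<in>uedges G. e \<subseteq> uverts G \<and> card e = 2)"

definition usubgraph :: "'a ugraph \<Rightarrow> 'a ugraph \<Rightarrow> bool" where
  "usubgraph H G \<longleftrightarrow>
     simple_graph H \<and> simple_graph G \<and> uverts H \<subseteq> uverts G \<and> uedges H \<subseteq> uedges G"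

definition ugraph_iso :: "'a ugraph \<Rightarrow> 'b ugraph \<Rightarrow> bool" where
  "ugraph_iso G H \<longleftrightarrow>
     (\<exists>f. bij_betw f (uverts G) (uverts H) \<and> uedges H = (\<lambda>e. f ` e) ` uedges G)"

definition contains_ucopy :: "'b ugraph \<Rightarrow> 'a ugraph \<Rightarrow> bool" where
  "contains_ucopy G F \<longleftrightarrow> (\<exists>H. usubgraph H G \<and> ugraph_iso F H)"

text \<open>Every \<open>n\<close>-vertex graph has an isomorphic copy with vertices of type \<^typ>\<open>nat\<close>.\<close>

definition turan_number :: "nat \<Rightarrow> 'a ugraph \<Rightarrow> nat" where
  "turan_number n F =
     Max {card (uedges G) | G :: nat ugraph.
            simple_graph G \<and> card (uverts G) = n \<and> \<not> contains_ucopy G F}"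

definition double_digraph :: "'a ugraph \<Rightarrow> 'a pair_pre_digraph" where
  "double_digraph F = \<lparr> pverts = uverts F, parcs = {(x, y). {x, y} \<in> uedges F} \<rparr>"

definition contains_dicopy :: "'b pair_pre_digraph \<Rightarrow> 'a pair_pre_digraph \<Rightarrow> bool" where
  "contains_dicopy D D' \<longleftrightarrow>
     (\<exists>H. subgraph H (with_proj D) \<and> digraph_iso (with_proj D') H)"

definition digraphs_on :: "nat \<Rightarrow> nat pair_pre_digraph set" where
  "digraphs_on n = {D. pair_digraph D \<and> pverts D = {1..n}}"

definition Forb :: "'a pair_pre_digraph \<Rightarrow> nat \<Rightarrow> nat pair_pre_digraph set" where
  "Forb D' n = {D \<in> digraphs_on n. \<not> contains_dicopy D D'}"

definition Kn_edges :: "nat \<Rightarrow> nat set set" where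
  "Kn_edges n = {e. e \<subseteq> {1..n} \<and> card e = 2}"

type_synonym colouring = "nat set \<Rightarrow> nat"
type_synonym template = "nat set \<Rightarrow> nat set"

definition encode :: "nat \<Rightarrow> nat pair_pre_digraph \<Rightarrow> colouring" where
  "encode n D = (\<lambda>e\<in>Kn_edges n.
     let i = Min e; j = Max e in
       if (i, j) \<notin> parcs D \<and> (j, i) \<notin> parcs D then 1
       else if (i, j) \<in> parcs D \<and> (j, i) \<notin> parcs D then 2
       else if (i, j) \<notin> parcs D \<and> (j, i) \<in> parcs D then 3
       else 4)"

definition colouring_property ::
  "(nat \<Rightarrow> nat pair_pre_digraph set) \<Rightarrow> nat \<Rightarrow> colouring set" where
  "colouring_property \<D> n = encode n ` \<D> n"

definition templates :: "nat \<Rightarrow> template set" where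
  "templates n = (Kn_edges n \<rightarrow>\<^sub>E Pow {1..4} - {{}})"

definition realisations :: "nat \<Rightarrow> template \<Rightarrow> colouring set" where
  "realisations n t = (\<Pi>\<^sub>E e\<in>Kn_edges n. t e)"

definition Ent :: "nat \<Rightarrow> template \<Rightarrow> real" where
  "Ent n t = (\<Sum>e\<in>Kn_edges n. log 4 (real (card (t e))))"

definition ex_entropy :: "nat \<Rightarrow> (nat \<Rightarrow> colouring set) \<Rightarrow> real" where
  "ex_entropy n \<P> = Max {Ent n t | t. t \<in> templates n \<and> realisations n t \<subseteq> \<P> n}"

end

theory Submission
  imports Defs
begin

text \<open>
  A digraph contains \<open>DF\<close> iff the graph of its bidirected pairs, i.e. of the pairs of colour 4,
  contains \<open>F\<close>. Hence all realisations of a template \<open>t\<close> are \<open>DF\<close>-free iff the graph of the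
  pairs \<open>e\<close> with \<open>4 \<in> t e\<close> is \<open>F\<close>-free. A pair of this graph contributes at most \<open>1\<close> to the
  entropy, any other pair at most \<open>log 4 3\<close>, and both bounds are attained simultaneously.
\<close>

section \<open>Copies as embeddings\<close>

text \<open>Copies need not be induced, so an edge-preserving injection suffices: the image of
  \<open>F\<close> under it is already a subgraph of \<open>G\<close> isomorphic to
  \<open>F\<close>. Injectivity keeps the images of edges two-element sets.\<close>

lemma contains_ucopy_iff_embedding:
  fixes F :: "'a ugraph" and G :: "'b ugraph"
  assumes F: "simple_graph F" and G: "simple_graph G"
  shows "contains_ucopy G F \<longleftrightarrow>
    (\<exists>f. inj_on f (uverts F) \<and> f ` uverts F \<subseteq> uverts G \<and> (\<forall>e\<in>uedges F. f ` e \<in> uedges G))"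
proof
  assume "contains_ucopy G F"
  then obtain H :: "'b ugraph" and f where "uverts H \<subseteq> uverts G" "uedges H \<subseteq> uedges G"
    "bij_betw f (uverts F) (uverts H)" "uedges H = (`) f ` uedges F"
    by (auto simp: contains_ucopy_def usubgraph_def ugraph_iso_def)
  then show "\<exists>f. inj_on f (uverts F) \<and> f ` uverts F \<subseteq> uverts G \<and> (\<forall>e\<in>uedges F. f ` e \<in> uedges G)"
    by (intro exI[of _ f]) (simp add: bij_betw_def image_subset_iff)
next
  assume "\<exists>f. inj_on f (uverts F) \<and> f ` uverts F \<subseteq> uverts G \<and> (\<forall>e\<in>uedges F. f ` e \<in> uedges G)"
  then obtain f where f: "inj_on f (uverts F)" "f ` uverts F \<subseteq> uverts G"
    "\<forall>e\<in>uedges F. f ` e \<in> uedges G"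
    by blast
  define H where "H = \<lparr>uverts = f ` uverts F, uedges = (`) f ` uedges F\<rparr>"
  have "card (f ` e) = 2" if "e \<in> uedges F" for e
    using that F f(1) by (metis card_image inj_on_subset simple_graph_def)
  then have "simple_graph H"
    using F by (auto simp: simple_graph_def H_def)
  then have "usubgraph H G"
    using f G by (auto simp: usubgraph_def H_def)
  moreover have "ugraph_iso F H"
    using f(1) by (auto simp: ugraph_iso_def H_def bij_betw_def)
  ultimately show "contains_ucopy G F"
    by (auto simp: contains_ucopy_def)
qed

lemma contains_ucopy_mono:
  assumes "contains_ucopy G F" "usubgraph G G'"
  shows "contains_ucopy G' F"
  using assms unfolding contains_ucopy_def usubgraph_def by (meson order_trans)

text \<open>A digraph isomorphism of the library carries separate maps on vertices and arcs as well
  as new tail and head functions. Compatibility with \<open>with_proj D\<close> forces the latter to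
  be \<open>fst\<close> and \<open>snd\<close>, so the vertex map determines the arc map.\<close>

lemma contains_dicopy_iff_embedding:
  assumes D: "pair_wf_digraph D" and D': "pair_wf_digraph D'"
  shows "contains_dicopy D D' \<longleftrightarrow>
    (\<exists>f. inj_on f (pverts D') \<and> f ` pverts D' \<subseteq> pverts D \<and>
      (\<forall>x y. (x, y) \<in> parcs D' \<longrightarrow> (f x, f y) \<in> parcs D))"
proof
  assume "contains_dicopy D D'"
  then obtain h where h: "subgraph (app_iso h (with_proj D')) (with_proj D)"
    "pre_digraph.digraph_isomorphism (with_proj D') h"
    by (auto simp: contains_dicopy_def digraph_iso_def)
  have tl: "iso_tail h = fst" and hd: "iso_head h = snd"
    using h(1) by (auto simp: subgraph_def compatible_def)
  have "(iso_verts h x, iso_verts h y) \<in> parcs D" if "(x, y) \<in> parcs D'" for x y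
  proof -
    have "iso_verts h x = fst (iso_arcs h (x, y))" "iso_verts h y = snd (iso_arcs h (x, y))"
      using h(2) that tl hd by (auto simp: pre_digraph.digraph_isomorphism_def)
    moreover have "iso_arcs h (x, y) \<in> parcs D"
      using h(1) that by (auto simp: subgraph_def)
    ultimately show ?thesis by simp
  qed
  moreover have "inj_on (iso_verts h) (pverts D')" "iso_verts h ` pverts D' \<subseteq> pverts D"
    using h by (auto simp: pre_digraph.digraph_isomorphism_def subgraph_def)
  ultimately show "\<exists>f. inj_on f (pverts D') \<and> f ` pverts D' \<subseteq> pverts D \<and>
      (\<forall>x y. (x, y) \<in> parcs D' \<longrightarrow> (f x, f y) \<in> parcs D)"
    by blast
next
  assume "\<exists>f. inj_on f (pverts D') \<and> f ` pverts D' \<subseteq> pverts D \<and>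
      (\<forall>x y. (x, y) \<in> parcs D' \<longrightarrow> (f x, f y) \<in> parcs D)"
  then obtain f where f: "inj_on f (pverts D')" "f ` pverts D' \<subseteq> pverts D"
    "\<And>x y. (x, y) \<in> parcs D' \<Longrightarrow> (f x, f y) \<in> parcs D"
    by blast
  \<comment> \<open>The arc map induced by \<open>f\<close>; the projections are kept as tail and
    head so that the image is compatible with \<open>with_proj D\<close>.\<close>
  define h where "h = \<lparr>iso_verts = f, iso_arcs = map_prod f f,
    iso_head = (snd :: 'a \<times> 'a \<Rightarrow> 'a), iso_tail = (fst :: 'a \<times> 'a \<Rightarrow> 'a)\<rparr>"
  have "parcs D' \<subseteq> pverts D' \<times> pverts D'"
    using D' by (auto simp: pair_wf_digraph_def)
  then have "inj_on (map_prod f f) (parcs D')"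
    using f(1) map_prod_inj_on inj_on_subset by blast
  then have iso: "pre_digraph.digraph_isomorphism (with_proj D') h"
    using f(1) D' by (auto simp: pre_digraph.digraph_isomorphism_def h_def wf_digraph_wp_iff)
  have "wf_digraph (app_iso h (with_proj D'))"
    using D' iso by (intro wf_digraph.wf_digraphI_app_iso) (simp_all add: wf_digraph_wp_iff)
  then have "subgraph (app_iso h (with_proj D')) (with_proj D)"
    using f D by (auto simp: subgraph_def compatible_def h_def wf_digraph_wp_iff)
  then show "contains_dicopy D D'"
    using iso by (auto simp: contains_dicopy_def digraph_iso_def)
qed

lemma pair_wf_double_digraph:
  assumes "simple_graph F"
  shows "pair_wf_digraph (double_digraph F)"
  using assms by unfold_locales (auto simp: double_digraph_def simple_graph_def)

section \<open>Colourings and digraphs\<close>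

text \<open>All of {1..n} is kept as vertex set, since \<open>F\<close> may have isolated vertices
  that a copy must also place.\<close>

definition colour_class :: "nat \<Rightarrow> colouring \<Rightarrow> nat \<Rightarrow> nat ugraph" where
  "colour_class n c k = \<lparr>uverts = {1..n}, uedges = {e \<in> Kn_edges n. c e = k}\<rparr>"

lemma colour_class_simps [simp]:
  "uverts (colour_class n c k) = {1..n}"
  "uedges (colour_class n c k) = {e \<in> Kn_edges n. c e = k}"
  by (simp_all add: colour_class_def)

lemma simple_graph_subset_Kn:
  "E \<subseteq> Kn_edges n \<Longrightarrow> simple_graph \<lparr>uverts = {1..n}, uedges = E\<rparr>"
  by (auto simp: simple_graph_def Kn_edges_def)

lemma simple_colour_class: "simple_graph (colour_class n c k)"
  unfolding colour_class_def by (rule simple_graph_subset_Kn) auto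

lemma finite_Kn_edges [simp]: "finite (Kn_edges n)"
  by (simp add: Kn_edges_def)

lemma card_Kn_edges: "card (Kn_edges n) = n choose 2"
  using n_subsets[of "{1..n}" 2] by (simp add: Kn_edges_def)

lemma doubleton_in_Kn_edges:
  "{x, y} \<in> Kn_edges n \<longleftrightarrow> x \<in> {1..n} \<and> y \<in> {1..n} \<and> x \<noteq> y"
  by (auto simp: Kn_edges_def card_insert_if)

lemma Kn_edgesE:
  assumes "e \<in> Kn_edges n"
  obtains i j where "e = {i, j}" "i < j" "i \<in> {1..n}" "j \<in> {1..n}" "Min e = i" "Max e = j"
proof -
  obtain x y where xy: "e = {x, y}" "x \<noteq> y"
    using assms by (auto simp: Kn_edges_def card_2_iff)
  show ?thesis
    using xy assms that[of x y] that[of y x]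
    by (cases "x < y") (auto simp: doubleton_in_Kn_edges insert_commute)
qed

text \<open>Colour 4 is symmetric in the two directions, so no order between \<open>x\<close> and
  \<open>y\<close> has to be assumed here.\<close>

lemma encode_eq_4_iff:
  assumes "{x, y} \<in> Kn_edges n"
  shows "encode n D {x, y} = 4 \<longleftrightarrow> (x, y) \<in> parcs D \<and> (y, x) \<in> parcs D"
  using assms
  by (cases x y rule: linorder_cases) (auto simp: encode_def Let_def doubleton_in_Kn_edges)

lemma encode_in_PiE: "encode n D \<in> Kn_edges n \<rightarrow>\<^sub>E {1..4}"
  by (auto simp: encode_def Let_def)

text \<open>Both kinds of copy are embeddings, so it suffices to compare the two conditions for one
  fixed injection \<open>f\<close>. An edge of \<open>F\<close> yields arcs both ways in
  \<open>DF\<close>, hence its image must be a bidirected pair of \<open>D\<close>.\<close>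

lemma contains_dicopy_double_iff:
  assumes F: "simple_graph F" and D: "D \<in> digraphs_on n"
  shows "contains_dicopy D (double_digraph F) \<longleftrightarrow>
    contains_ucopy (colour_class n (encode n D) 4) F"
proof -
  have wf: "pair_wf_digraph D"
    using D by (simp add: digraphs_on_def pair_digraph_def pair_fin_digraph_def)
  have "(\<forall>x y. {x, y} \<in> uedges F \<longrightarrow> (f x, f y) \<in> parcs D) \<longleftrightarrow>
      (\<forall>e\<in>uedges F. f ` e \<in> uedges (colour_class n (encode n D) 4))"
    if f: "inj_on f (uverts F)" "f ` uverts F \<subseteq> {1..n}" for f
  proof -
    \<comment> \<open>Injectivity keeps the two ends of an edge apart, so the image is a pair to
      which the colouring assigns a colour.\<close>
    have Kn: "f ` e \<in> Kn_edges n" if "e \<in> uedges F" for e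
    proof -
      have "e \<subseteq> uverts F" "card e = 2"
        using that F by (auto simp: simple_graph_def)
      then show ?thesis
        using f by (auto simp: Kn_edges_def card_image inj_on_subset)
    qed
    have edge: "\<exists>x y. e = {x, y}" if "e \<in> uedges F" for e
      using that F by (metis card_2_iff simple_graph_def)
    have four: "f ` {x, y} \<in> uedges (colour_class n (encode n D) 4) \<longleftrightarrow>
        (f x, f y) \<in> parcs D \<and> (f y, f x) \<in> parcs D" if "{x, y} \<in> uedges F" for x y
      using Kn[OF that] encode_eq_4_iff[of "f x" "f y" n D] by simp
    show ?thesis
    proof (intro iffI ballI allI impI)
      fix e assume *: "\<forall>x y. {x, y} \<in> uedges F \<longrightarrow> (f x, f y) \<in> parcs D" and e: "e \<in> uedges F"
      obtain x y where xy: "e = {x, y}" using edge[OF e] by blast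
      \<comment> \<open>The second arc comes from reading the same edge as {y, x}.\<close>
      have "(f x, f y) \<in> parcs D" "(f y, f x) \<in> parcs D"
        using * e xy by (simp_all add: insert_commute)
      then show "f ` e \<in> uedges (colour_class n (encode n D) 4)"
        using four e xy by blast
    next
      fix x y assume *: "\<forall>e\<in>uedges F. f ` e \<in> uedges (colour_class n (encode n D) 4)"
        and e: "{x, y} \<in> uedges F"
      show "(f x, f y) \<in> parcs D"
        using four[OF e] * e by blast
    qed
  qed
  then show ?thesis
    unfolding contains_dicopy_iff_embedding[OF wf pair_wf_double_digraph[OF F]]
      contains_ucopy_iff_embedding[OF F simple_colour_class]
    using D by (auto simp: double_digraph_def digraphs_on_def)
qed

text \<open>This allows properties of digraphs to be tested on arbitrary colourings, in particular
  on every realisation of a template.\<close>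

lemma encode_surj:
  assumes c: "c \<in> Kn_edges n \<rightarrow>\<^sub>E {1..4}"
  shows "\<exists>D\<in>digraphs_on n. encode n D = c"
proof -
  \<comment> \<open>Inverts the encoding: besides 4, the colour that yields the arc (x, y) is 2 if
    it ascends and 3 if it descends. Colour 1 yields no arc.\<close>
  define D where "D = \<lparr>pverts = {1..n}, parcs = {(x, y). {x, y} \<in> Kn_edges n \<and>
    (c {x, y} = 4 \<or> c {x, y} = (if x < y then 2 else 3))}\<rparr>"
  have sub: "parcs D \<subseteq> {1..n} \<times> {1..n}"
    by (auto simp: D_def doubleton_in_Kn_edges)
  then have "finite (parcs D)"
    by (rule finite_subset) simp
  then have "D \<in> digraphs_on n"
    using sub unfolding digraphs_on_def mem_Collect_eq
    by (intro conjI, unfold_locales) (auto simp: D_def doubleton_in_Kn_edges)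
  moreover have "encode n D = c"
  proof (rule PiE_ext[OF encode_in_PiE c])
    fix e assume e: "e \<in> Kn_edges n"
    then obtain i j where ij: "e = {i, j}" "i < j" "Min e = i" "Max e = j"
      by (rule Kn_edgesE)
    have arcs: "(i, j) \<in> parcs D \<longleftrightarrow> c e = 4 \<or> c e = 2" "(j, i) \<in> parcs D \<longleftrightarrow> c e = 4 \<or> c e = 3"
      using e ij by (auto simp: D_def insert_commute)
    have "c e \<in> {1..4}"
      using c e by (rule PiE_mem)
    then have "c e = 1 \<or> c e = 2 \<or> c e = 3 \<or> c e = 4"
      by auto
    then show "encode n D e = c e"
      using e ij(3,4) arcs by (auto simp: encode_def)
  qed
  ultimately show ?thesis by blast
qed

text \<open>Every colouring encodes some digraph, and whether that digraph is \<open>DF\<close>-free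
  depends on colour class 4 alone; digraphs thus disappear from the rest of the argument.\<close>

lemma colouring_property_Forb_double:
  assumes F: "simple_graph F"
  shows "colouring_property (Forb (double_digraph F)) n =
    {c \<in> Kn_edges n \<rightarrow>\<^sub>E {1..4}. \<not> contains_ucopy (colour_class n c 4) F}"
proof (intro equalityI subsetI)
  fix c assume "c \<in> colouring_property (Forb (double_digraph F)) n"
  then obtain D where "c = encode n D" "D \<in> digraphs_on n" "\<not> contains_dicopy D (double_digraph F)"
    by (auto simp: colouring_property_def Forb_def)
  then show "c \<in> {c \<in> Kn_edges n \<rightarrow>\<^sub>E {1..4}. \<not> contains_ucopy (colour_class n c 4) F}"
    using contains_dicopy_double_iff[OF F] encode_in_PiE by auto
next
  fix c assume c: "c \<in> {c \<in> Kn_edges n \<rightarrow>\<^sub>E {1..4}. \<not> contains_ucopy (colour_class n c 4) F}"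
  then obtain D where "D \<in> digraphs_on n" "encode n D = c"
    using encode_surj by blast
  then show "c \<in> colouring_property (Forb (double_digraph F)) n"
    using c contains_dicopy_double_iff[OF F] by (auto simp: colouring_property_def Forb_def)
qed

section \<open>Templates\<close>

definition template_graph :: "nat \<Rightarrow> template \<Rightarrow> nat ugraph" where
  "template_graph n t = \<lparr>uverts = {1..n}, uedges = {e \<in> Kn_edges n. 4 \<in> t e}\<rparr>"

text \<open>The template graph is the largest colour-4 class of a realisation: it contains all of
  them and is attained by one. Being \<open>F\<close>-free passes to subgraphs, so only that
  realisation matters.\<close>

lemma realisations_Forb_iff:
  assumes F: "simple_graph F" and t: "t \<in> templates n"
  shows "realisations n t \<subseteq> colouring_property (Forb (double_digraph F)) n \<longleftrightarrow>
    \<not> contains_ucopy (template_graph n t) F"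
proof
  assume sub: "realisations n t \<subseteq> colouring_property (Forb (double_digraph F)) n"
  \<comment> \<open>The realisation that uses colour 4 wherever allowed. Elsewhere any allowed
    colour serves: one exists because templates have nonempty values, and it cannot be 4.\<close>
  define c where "c = (\<lambda>e\<in>Kn_edges n. if 4 \<in> t e then 4 else SOME k. k \<in> t e)"
  have "t e \<noteq> {}" if "e \<in> Kn_edges n" for e
    using t that by (auto simp: templates_def)
  then have c: "c \<in> realisations n t"
    by (auto simp: realisations_def c_def some_in_eq)
  then have "4 \<in> t e \<longleftrightarrow> c e = 4" if "e \<in> Kn_edges n" for e
    using that PiE_mem[of c "Kn_edges n" t e] by (auto simp: c_def realisations_def)
  then have "template_graph n t = colour_class n c 4"
    by (auto simp: template_graph_def colour_class_def)
  then show "\<not> contains_ucopy (template_graph n t) F"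
    using c sub colouring_property_Forb_double[OF F] by auto
next
  assume free: "\<not> contains_ucopy (template_graph n t) F"
  show "realisations n t \<subseteq> colouring_property (Forb (double_digraph F)) n"
  proof
    fix c assume c: "c \<in> realisations n t"
    have ct: "c e \<in> t e" if "e \<in> Kn_edges n" for e
      using c that by (auto simp: realisations_def dest: PiE_mem)
    moreover have "t e \<subseteq> {1..4}" if "e \<in> Kn_edges n" for e
      using t that by (auto simp: templates_def dest: PiE_mem)
    ultimately have "c \<in> Kn_edges n \<rightarrow>\<^sub>E {1..4}"
      using c by (auto simp: realisations_def PiE_iff simp del: atLeastAtMost_iff)
    moreover have "usubgraph (colour_class n c 4) (template_graph n t)"
      unfolding usubgraph_def template_graph_def colour_class_def
      using ct by (intro conjI simple_graph_subset_Kn) (auto, metis)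
    ultimately show "c \<in> colouring_property (Forb (double_digraph F)) n"
      using free contains_ucopy_mono colouring_property_Forb_double[OF F] by blast
  qed
qed

section \<open>Entropy of a template against the number of edges of its graph\<close>

lemma sum_indicator_weight:
  fixes a :: real
  assumes "finite A" "B \<subseteq> A"
  shows "(\<Sum>e\<in>A. if e \<in> B then 1 else a) = (1 - a) * real (card B) + a * real (card A)"
proof -
  have "(\<Sum>e\<in>A. if e \<in> B then 1 else a) = (\<Sum>e\<in>A. (1 - a) * (if e \<in> B then 1 else 0) + a)"
    by (intro sum.cong) auto
  also have "\<dots> = (1 - a) * (\<Sum>e\<in>A. if e \<in> B then 1 else 0) + a * real (card A)"
    by (simp add: sum.distrib sum_distrib_left)
  also have "(\<Sum>e\<in>A. if e \<in> B then 1 else 0) = real (card B)"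
    using assms by (simp add: sum.If_cases Int_absorb1)
  finally show ?thesis .
qed

lemma Ent_le_template_graph:
  assumes t: "t \<in> templates n"
  shows "Ent n t \<le> (1 - log 4 3) * real (card (uedges (template_graph n t))) +
    log 4 3 * real (n choose 2)"
proof -
  let ?E = "uedges (template_graph n t)"
  have "log 4 (real (card (t e))) \<le> (if e \<in> ?E then 1 else log 4 3)" if e: "e \<in> Kn_edges n" for e
  proof -
    have te: "t e \<subseteq> {1..4}" "t e \<noteq> {}"
      using t e by (auto simp: templates_def dest: PiE_mem)
    \<comment> \<open>The comparisons of logarithms below require positive arguments.\<close>
    then have pos: "card (t e) > 0"
      by (meson card_gt_0_iff finite_atLeastAtMost finite_subset)
    show ?thesis
    proof (cases "4 \<in> t e")
      case True
      have "card (t e) \<le> 4"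
        using card_mono[OF _ te(1)] by simp
      then have "log 4 (real (card (t e))) \<le> log 4 4"
        using pos by (subst log_le_cancel_iff) auto
      then show ?thesis
        using True e by (simp add: template_graph_def)
    next
      case False
      have "t e \<subseteq> {1..3}"
      proof
        fix k assume "k \<in> t e"
        then have "k \<in> {1..4}" "k \<noteq> 4"
          using te(1) False by auto
        then show "k \<in> {1..3}" by auto
      qed
      then have "card (t e) \<le> 3"
        using card_mono[of "{1..3::nat}"] by simp
      then have "log 4 (real (card (t e))) \<le> log 4 3"
        using pos by (subst log_le_cancel_iff) auto
      then show ?thesis
        using False by (simp add: template_graph_def)
    qed
  qed
  then have "Ent n t \<le> (\<Sum>e\<in>Kn_edges n. if e \<in> ?E then 1 else log 4 3)"
    unfolding Ent_def by (rule sum_mono)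
  also have "\<dots> = (1 - log 4 3) * real (card ?E) + log 4 3 * real (n choose 2)"
    by (subst sum_indicator_weight) (auto simp: template_graph_def card_Kn_edges)
  finally show ?thesis .
qed

text \<open>For a prescribed \<open>E\<close> this template takes the largest palettes that make
  \<open>E\<close> its graph, so it attains equality in
  \<open>Ent_le_template_graph\<close>.\<close>

lemma Ent_full_or_three:
  assumes "E \<subseteq> Kn_edges n"
  defines "t \<equiv> (\<lambda>e\<in>Kn_edges n. if e \<in> E then {1..4} else {1..3})"
  shows "t \<in> templates n"
    and "template_graph n t = \<lparr>uverts = {1..n}, uedges = E\<rparr>"
    and "Ent n t = (1 - log 4 3) * real (card E) + log 4 3 * real (n choose 2)"
proof -
  show "t \<in> templates n"
    by (auto simp: templates_def t_def)
  show "template_graph n t = \<lparr>uverts = {1..n}, uedges = E\<rparr>"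
    using assms(1) by (auto simp: template_graph_def t_def split: if_splits)
  have "Ent n t = (\<Sum>e\<in>Kn_edges n. if e \<in> E then 1 else log 4 3)"
    unfolding Ent_def by (intro sum.cong) (auto simp: t_def)
  then show "Ent n t = (1 - log 4 3) * real (card E) + log 4 3 * real (n choose 2)"
    using assms(1) by (simp add: sum_indicator_weight card_Kn_edges)
qed

section \<open>Extremal graphs\<close>

text \<open>The Turan number ranges over graphs on any \<open>n\<close> naturals, whereas template
  graphs live on {1..n}. Edges are transported along a bijection \<open>g\<close>; its inverse
  \<open>h\<close> pulls a copy of \<open>F\<close> back into \<open>G\<close>.\<close>

lemma F_free_relabel:
  fixes G :: "nat ugraph"
  assumes F: "simple_graph F" and G: "simple_graph G" "card (uverts G) = n" "\<not> contains_ucopy G F"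
  obtains E where "E \<subseteq> Kn_edges n" "card E = card (uedges G)"
    "\<not> contains_ucopy \<lparr>uverts = {1..n}, uedges = E\<rparr> F"
proof -
  have "finite (uverts G)"
    using G(1) by (simp add: simple_graph_def)
  then obtain g where g: "bij_betw g (uverts G) {1..n}"
    using finite_same_card_bij[of "uverts G" "{1..n}"] G(2) by auto
  define h where "h = the_inv_into (uverts G) g"
  have h: "bij_betw h {1..n} (uverts G)"
    unfolding h_def using g by (rule bij_betw_the_inv_into)
  have hg: "h (g x) = x" if "x \<in> uverts G" for x
    using g that by (simp add: h_def the_inv_into_f_f bij_betw_def)
  define E where "E = (`) g ` uedges G"
  have sub: "e \<subseteq> uverts G" "card e = 2" if "e \<in> uedges G" for e
    using that G(1) by (auto simp: simple_graph_def)
  \<comment> \<open>Distinct edges have distinct images, so relabelling preserves the edge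
    count.\<close>
  have inj: "inj_on ((`) g) (uedges G)"
    using g sub(1) by (auto simp: bij_betw_def inj_on_def inj_on_image_eq_iff)
  have E: "E \<subseteq> Kn_edges n"
  proof
    fix e assume "e \<in> E"
    then obtain e' where e': "e' \<in> uedges G" "e = g ` e'"
      by (auto simp: E_def)
    then have "card e = 2" "e \<subseteq> g ` uverts G"
      using sub[OF e'(1)] g by (auto simp: card_image bij_betw_def inj_on_subset)
    then show "e \<in> Kn_edges n"
      using g by (auto simp: Kn_edges_def bij_betw_def)
  qed
  have "\<not> contains_ucopy \<lparr>uverts = {1..n}, uedges = E\<rparr> F"
  proof
    assume "contains_ucopy \<lparr>uverts = {1..n}, uedges = E\<rparr> F"
    then obtain f where f: "inj_on f (uverts F)" "f ` uverts F \<subseteq> {1..n}" "\<forall>e\<in>uedges F. f ` e \<in> E"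
      using contains_ucopy_iff_embedding[OF F simple_graph_subset_Kn[OF E]] by auto
    have "inj_on (h \<circ> f) (uverts F)"
      using f(1,2) h by (meson bij_betw_imp_inj_on comp_inj_on inj_on_subset)
    moreover have "(h \<circ> f) ` uverts F \<subseteq> uverts G"
      using f(2) h by (auto simp: bij_betw_def image_subset_iff)
    moreover have "(h \<circ> f) ` e \<in> uedges G" if "e \<in> uedges F" for e
    proof -
      have "f ` e \<in> (`) g ` uedges G"
        using f(3) that by (simp add: E_def)
      then obtain e' where e': "e' \<in> uedges G" "f ` e = g ` e'"
        by (rule imageE)
      have "(h \<circ> f) ` e = h ` g ` e'"
        by (metis e'(2) image_comp)
      also have "\<dots> = e'"
        using hg sub(1)[OF e'(1)] by (simp add: image_image subset_iff)
      finally show ?thesis using e'(1) by simp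
    qed
    ultimately show False
      using contains_ucopy_iff_embedding[OF F G(1)] G(3) by blast
  qed
  then show ?thesis
    using that E inj by (simp add: E_def card_image)
qed

text \<open>The two sets of edge counts coincide, not merely their maxima. The new form ranges over
  subsets of a finite set and matches the graphs of templates.\<close>

lemma turan_number_eq_Max:
  fixes F :: "'a ugraph"
  assumes F: "simple_graph F"
  shows "turan_number n F = Max {card E | E. E \<subseteq> Kn_edges n \<and>
    \<not> contains_ucopy \<lparr>uverts = {1..n}, uedges = E\<rparr> F}" (is "_ = Max ?B")
proof -
  have "{card (uedges G) | G :: nat ugraph.
      simple_graph G \<and> card (uverts G) = n \<and> \<not> contains_ucopy G F} = ?B" (is "?A = _")
  proof (intro equalityI subsetI)
    fix k assume "k \<in> ?A"
    then obtain G :: "nat ugraph" where G: "k = card (uedges G)" "simple_graph G"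
      "card (uverts G) = n" "\<not> contains_ucopy G F"
      by blast
    obtain E where "E \<subseteq> Kn_edges n" "card E = card (uedges G)"
      "\<not> contains_ucopy \<lparr>uverts = {1..n}, uedges = E\<rparr> F"
      using F G(2-4) by (rule F_free_relabel)
    then show "k \<in> ?B"
      unfolding G(1) by (intro CollectI exI[of _ E]) simp
  next
    fix k assume "k \<in> ?B"
    then obtain E where E: "k = card E" "E \<subseteq> Kn_edges n"
      "\<not> contains_ucopy \<lparr>uverts = {1..n}, uedges = E\<rparr> F"
      by blast
    then show "k \<in> ?A"
      using simple_graph_subset_Kn
      by (intro CollectI exI[of _ "\<lparr>uverts = {1..n}, uedges = E\<rparr>"]) auto
  qed
  then show ?thesis by (simp add: turan_number_def)
qed

section \<open>Equality of the two extremal quantities\<close>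

theorem theorem4p3:
  fixes F :: "'a ugraph" and n :: nat
  assumes "simple_graph F" and "uedges F \<noteq> {}"
  shows "ex_entropy n (colouring_property (Forb (double_digraph F))) =
           (1 - log 4 3) * real (turan_number n F) + log 4 3 * real (n choose 2)"
proof -
  let ?free = "\<lambda>E. E \<subseteq> Kn_edges n \<and> \<not> contains_ucopy \<lparr>uverts = {1..n}, uedges = E\<rparr> F"
  let ?K = "{card E | E. ?free E}"
  have turan: "turan_number n F = Max ?K"
    using assms(1) by (rule turan_number_eq_Max)
  have "?K = card ` {E. ?free E}" by blast
  moreover have "finite {E. ?free E}"
    by (rule finite_subset[of _ "Pow (Kn_edges n)"]) auto
  ultimately have fin: "finite ?K" by simp
  \<comment> \<open>An edge of \<open>F\<close> has nowhere to go in the empty graph. This is where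
    \<open>uedges F \<noteq> {}\<close> enters: it ensures that \<open>Max ?K\<close> is a genuine
    maximum, attained by some \<open>E\<close>.\<close>
  have "?free {}"
    using contains_ucopy_iff_embedding[OF assms(1) simple_graph_subset_Kn[of "{}" n]] assms(2)
    by auto
  then have "?K \<noteq> {}" by blast
  then have "Max ?K \<in> ?K"
    using fin by (rule Max_in[rotated])
  then obtain E where E: "?free E" "card E = turan_number n F"
    using turan by auto
  define t where "t = (\<lambda>e\<in>Kn_edges n. if e \<in> E then {1..4} else {1..3::nat})"
  have t: "t \<in> templates n" "template_graph n t = \<lparr>uverts = {1..n}, uedges = E\<rparr>"
    "Ent n t = (1 - log 4 3) * real (turan_number n F) + log 4 3 * real (n choose 2)"
    using Ent_full_or_three[of E n] E unfolding t_def by auto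
  show ?thesis
    unfolding ex_entropy_def
  proof (rule Max_eqI)
    \<comment> \<open>Finitely many templates have finitely many entropies, as \<open>Max\<close>
      demands.\<close>
    have "finite (templates n)"
      by (simp add: templates_def finite_PiE)
    then show "finite {Ent n t | t. t \<in> templates n \<and>
        realisations n t \<subseteq> colouring_property (Forb (double_digraph F)) n}"
      by simp
  next
    fix r assume "r \<in> {Ent n t | t. t \<in> templates n \<and>
        realisations n t \<subseteq> colouring_property (Forb (double_digraph F)) n}"
    then obtain s where s: "r = Ent n s" "s \<in> templates n" "\<not> contains_ucopy (template_graph n s) F"
      using realisations_Forb_iff[OF assms(1)] by blast
    then have "?free (uedges (template_graph n s))"
      by (auto simp: template_graph_def)
    then have "card (uedges (template_graph n s)) \<le> turan_number n F"
      unfolding turan using fin by (intro Max_ge) auto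
    \<comment> \<open>The coefficient 1 - log 4 3 is nonnegative, so a bound on the edge count
      becomes a bound on the entropy.\<close>
    moreover have "log 4 3 \<le> (1::real)"
      by simp
    ultimately have "(1 - log 4 3) * real (card (uedges (template_graph n s)))
        \<le> (1 - log 4 3) * real (turan_number n F)"
      by (intro mult_left_mono) auto
    then show "r \<le> (1 - log 4 3) * real (turan_number n F) + log 4 3 * real (n choose 2)"
      using Ent_le_template_graph[OF s(2)] s(1) by linarith
  next
    have "realisations n t \<subseteq> colouring_property (Forb (double_digraph F)) n"
      using realisations_Forb_iff[OF assms(1) t(1)] t(2) E(1) by simp
    then show "(1 - log 4 3) * real (turan_number n F) + log 4 3 * real (n choose 2)
        \<in> {Ent n t | t. t \<in> templates n \<and>
          realisations n t \<subseteq> colouring_property (Forb (double_digraph F)) n}"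
      using t(1,3) by force
  qed
qed

end
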